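(* Let $A$ be a formula of $L$ and $\Gamma$ a set of formulas of $L$. If $A$ is a tautological consequence of $\Gamma$ in the sense of classical semantics, then $A$ is a DI9 logical consequence of $\Gamma$.
   Context: $L$ is a standard language of classical propositional logic: its formulas are built recursively from an infinite set of atomic formulas by the primitive connectives negation ($\sim$) and disjunction ($\vee$). "Number" means real number. There are three distinct values $T, F, 0$; $T$ and $F$ are called truth values. A DI9 valuation for $L$ is a function $\alpha$ from (atomic formulas of $L$) $\times\ \mathbb{R}$ to $\{T,F,0\}$ such that for every atomic formula $A$: (1) for all numbers $j<h$, if $\alpha(A,j)=T$ then $\alpha(A,h)=T$, and if $\alpha(A,j)=F$ then $\alpha(A,h)=F$; (2) there is a number $j$ with $\alpha(A,j)=T$ or $\alpha(A,j)=F$. For a DI9 valuation $\alpha$, the DI9 classical interpretation associated to $\alpha$ is the function $\alpha^*$ from formulas of $L$ to $\{T,F\}$ such that: for atomic $A$, $\alpha^*(A)=T$ iff there is a $j$ with $\alpha(A,j)=T$; $\alpha^*(\sim B)=T$ iff $\alpha^*(B)=F$; $\alpha^*(B\vee C)=T$ iff $\alpha^*(B)=T$ or $\alpha^*(C)=T$. For a number $j$, a DI9 valuation $\beta$ is a $j$-extension of a DI9 valuation $\alpha$ iff $\beta(A,h)=\alpha(A,h)$ for every atomic formula $A$ and every number $h\le j$. For a DI9 valuation $\alpha$, the DI9 interpretation $I\alpha$ is the function from (formulas of $L$) $\times\ \mathbb{R}$ to $\{T,F,0\}$ defined recursively by: $I\alpha(A,j)=\alpha(A,j)$ for atomic $A$;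 $I\alpha(\sim B,j)=T$ iff $I\alpha(B,j)=F$, $I\alpha(\sim B,j)=F$ iff $I\alpha(B,j)=T$, $I\alpha(\sim B,j)=0$ iff $I\alpha(B,j)=0$; $I\alpha(B\vee C,j)=T$ iff for every $j$-extension $\beta$ of $\alpha$, $\beta^*(B)=T$ or $\beta^*(C)=T$; $I\alpha(B\vee C,j)=F$ iff for every $j$-extension $\beta$ of $\alpha$, $\beta^*(B)=F$ and $\beta^*(C)=F$; and $I\alpha(B\vee C,j)=0$ otherwise. $I\alpha$ satisfies a formula $A$ at a number $j$ iff $I\alpha(A,j)=T$. A formula $A$ is a DI9 logical consequence of a set $\Gamma$ of formulas iff, for every number $j$, every DI9 interpretation for $L$ that satisfies all elements of $\Gamma$ at $j$ also satisfies $A$ at $j$. An interpretation for $L$ in the sense of classical semantics is a function $v$ from formulas of $L$ to $\{T,F\}$ with $v(\sim B)=T$ iff $v(B)=F$, and $v(B\vee C)=T$ iff $v(B)=T$ or $v(C)=T$. $A$ is a tautological consequence of $\Gamma$ iff every such $v$ with $v(B)=T$ for all $B\in\Gamma$ has $v(A)=T$. *)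

theory Defs
  imports Complex_Main
begin

datatype val = T | F | Zero

datatype 'a form = Atom 'a | Neg "'a form" | Disj "'a form" "'a form"

definition DI9_valuation :: "('a \<Rightarrow> real \<Rightarrow> val) \<Rightarrow> bool" where
  "DI9_valuation \<alpha> \<longleftrightarrow>
     (\<forall>A. (\<forall>j h. j < h \<longrightarrow> (\<alpha> A j = T \<longrightarrow> \<alpha> A h = T) \<and> (\<alpha> A j = F \<longrightarrow> \<alpha> A h = F)) \<and>
          (\<exists>j. \<alpha> A j = T \<or> \<alpha> A j = F))"

primrec DI9_classical :: "('a \<Rightarrow> real \<Rightarrow> val) \<Rightarrow> 'a form \<Rightarrow> val" where
  "DI9_classical \<alpha> (Atom A) = (if \<exists>j. \<alpha> A j = T then T else F)"
| "DI9_classical \<alpha> (Neg B) = (if DI9_classical \<alpha> B = F then T else F)"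
| "DI9_classical \<alpha> (Disj B C) =
     (if DI9_classical \<alpha> B = T \<or> DI9_classical \<alpha> C = T then T else F)"

definition extension_at ::
  "real \<Rightarrow> ('a \<Rightarrow> real \<Rightarrow> val) \<Rightarrow> ('a \<Rightarrow> real \<Rightarrow> val) \<Rightarrow> bool" where
  "extension_at j \<beta> \<alpha> \<longleftrightarrow>
     DI9_valuation \<beta> \<and> DI9_valuation \<alpha> \<and> (\<forall>A. \<forall>h\<le>j. \<beta> A h = \<alpha> A h)"

text \<open>In the disjunction clause the order of the two tests is immaterial when \<open>\<alpha>\<close> is a
  DI9 valuation: \<open>\<alpha>\<close> is then a \<open>j\<close>-extension of itself, so the conditions for \<open>T\<close> and \<open>F\<close>
  exclude each other. Only DI9 valuations are used below.\<close>

primrec DI9_interp :: "('a \<Rightarrow> real \<Rightarrow> val) \<Rightarrow> 'a form \<Rightarrow> real \<Rightarrow> val" where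
  "DI9_interp \<alpha> (Atom A) j = \<alpha> A j"
| "DI9_interp \<alpha> (Neg B) j =
     (case DI9_interp \<alpha> B j of T \<Rightarrow> F | F \<Rightarrow> T | Zero \<Rightarrow> Zero)"
| "DI9_interp \<alpha> (Disj B C) j =
     (if \<forall>\<beta>. extension_at j \<beta> \<alpha> \<longrightarrow> DI9_classical \<beta> B = T \<or> DI9_classical \<beta> C = T then T
      else if \<forall>\<beta>. extension_at j \<beta> \<alpha> \<longrightarrow> DI9_classical \<beta> B = F \<and> DI9_classical \<beta> C = F then F
      else Zero)"

definition satisfies_at :: "('a form \<Rightarrow> real \<Rightarrow> val) \<Rightarrow> 'a form \<Rightarrow> real \<Rightarrow> bool" where
  "satisfies_at I A j \<longleftrightarrow> I A j = T"

definition DI9_consequence :: "'a form set \<Rightarrow> 'a form \<Rightarrow> bool" where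
  "DI9_consequence \<Gamma> A \<longleftrightarrow>
     (\<forall>j \<alpha>. DI9_valuation \<alpha> \<longrightarrow>
        (\<forall>B\<in>\<Gamma>. satisfies_at (DI9_interp \<alpha>) B j) \<longrightarrow> satisfies_at (DI9_interp \<alpha>) A j)"

definition classical_interpretation :: "('a form \<Rightarrow> val) \<Rightarrow> bool" where
  "classical_interpretation v \<longleftrightarrow>
     (\<forall>B. v B \<in> {T, F}) \<and>
     (\<forall>B. v (Neg B) = T \<longleftrightarrow> v B = F) \<and>
     (\<forall>B C. v (Disj B C) = T \<longleftrightarrow> v B = T \<or> v C = T)"

definition tautological_consequence :: "'a form set \<Rightarrow> 'a form \<Rightarrow> bool" where
  "tautological_consequence \<Gamma> A \<longleftrightarrow>
     (\<forall>v. classical_interpretation v \<longrightarrow> (\<forall>B\<in>\<Gamma>. v B = T) \<longrightarrow> v A = T)"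

end

(* An atom undecided at j can be decided either way after j, so the value of an atom at j is a
   truth value exactly when the classical interpretations of all j-extensions agree on it. By
   induction this supervaluation reading extends from atoms and disjunctions to all formulas;
   since every classical interpretation of a j-extension is a classical interpretation of the
   language, tautological consequence is preserved. *)
theory Submission
  imports Defs
begin

text \<open>Keeps the history up to \<open>j\<close> and settles at once, as \<open>v\<close>, every
  atom still open at \<open>j\<close>; this is the source of extensions with a prescribed
  verdict.\<close>

definition decide_after :: "real \<Rightarrow> val \<Rightarrow> ('a \<Rightarrow> real \<Rightarrow> val) \<Rightarrow> 'a \<Rightarrow> real \<Rightarrow> val" where
  "decide_after j v \<alpha> X h = (if h \<le> j then \<alpha> X h else if \<alpha> X j = Zero then v else \<alpha> X j)"

lemma DI9_valuation_mono:
  assumes "DI9_valuation \<alpha>" "j \<le> h" "\<alpha> X j = v" "v \<noteq> Zero"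
  shows "\<alpha> X h = v"
  using assms unfolding DI9_valuation_def by (cases v) (metis order_le_less)+

lemma decide_after_extension:
  assumes "DI9_valuation \<alpha>" "v \<noteq> Zero"
  shows "extension_at j (decide_after j v \<alpha>) \<alpha>"
proof -
  \<comment> \<open>After \<open>j\<close> the new value is constant, so the delicate case is
    \<open>k \<le> j < h\<close>: there \<open>w\<close> persists in \<open>\<alpha>\<close> up to
    \<open>j\<close> and is then carried on.\<close>
  have "decide_after j v \<alpha> X h = w"
    if "k < h" "decide_after j v \<alpha> X k = w" "w \<noteq> Zero" for X k h w
    using that DI9_valuation_mono[OF assms(1), of k h X w] DI9_valuation_mono[OF assms(1), of k j X w]
    by (auto simp: decide_after_def split: if_splits)
  moreover have "decide_after j v \<alpha> X (j + 1) \<noteq> Zero" for X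
    using assms(2) by (simp add: decide_after_def)
  ultimately have "DI9_valuation (decide_after j v \<alpha>)"
    unfolding DI9_valuation_def by (intro allI conjI impI) (blast, blast, meson val.exhaust)
  then show ?thesis
    using assms(1) by (simp add: extension_at_def decide_after_def)
qed

lemma DI9_classical_not_Zero: "DI9_classical \<beta> B \<noteq> Zero"
  by (cases B) auto

lemma classical_interpretation_DI9_classical: "classical_interpretation (DI9_classical \<beta>)"
proof -
  have "DI9_classical \<beta> B \<in> {T, F}" for B
    using DI9_classical_not_Zero[of \<beta> B] by (cases "DI9_classical \<beta> B") auto
  then show ?thesis
    by (simp add: classical_interpretation_def)
qed

text \<open>One truth value excludes the other at all times: whichever comes first would persist to
  the time of the second.\<close>

lemma DI9_classical_Atom_eq:
  assumes "DI9_valuation \<beta>" "\<beta> X j = v" "v \<noteq> Zero"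
  shows "DI9_classical \<beta> (Atom X) = v"
proof (cases v)
  case F
  have "\<beta> X h \<noteq> T" for h
    using DI9_valuation_mono[OF assms(1), of j h X F] DI9_valuation_mono[OF assms(1), of h j X T]
      assms(2) F by (cases "j \<le> h") auto
  then show ?thesis using F by simp
qed (use assms in auto)

text \<open>\<open>Zero\<close> is excluded because no classical interpretation takes it, while
  \<open>\<alpha>\<close> extends itself. Both truth values go through one induction, since negation
  swaps them.\<close>

lemma DI9_interp_supervaluation:
  assumes "DI9_valuation \<alpha>" "v \<noteq> Zero"
  shows "DI9_interp \<alpha> B j = v \<longleftrightarrow> (\<forall>\<beta>. extension_at j \<beta> \<alpha> \<longrightarrow> DI9_classical \<beta> B = v)"
  using assms(2)
proof (induction B arbitrary: v)
  case (Atom X)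
  show ?case
  proof
    assume "DI9_interp \<alpha> (Atom X) j = v"
    then show "\<forall>\<beta>. extension_at j \<beta> \<alpha> \<longrightarrow> DI9_classical \<beta> (Atom X) = v"
      using Atom DI9_classical_Atom_eq[of _ X j v] by (auto simp: extension_at_def)
  next
    assume all: "\<forall>\<beta>. extension_at j \<beta> \<alpha> \<longrightarrow> DI9_classical \<beta> (Atom X) = v"
    \<comment> \<open>Here \<open>w\<close> ranges over the verdicts on \<open>X\<close> still
      possible at \<open>j\<close>. Were \<open>X\<close> open at \<open>j\<close>, both
      \<open>T\<close> and \<open>F\<close> would qualify and equal \<open>v\<close>; so
      \<open>X\<close> is decided, and its value is \<open>v\<close>.\<close>
    have "w = v" if "w \<noteq> Zero" "\<alpha> X j \<in> {Zero, w}" for w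
    proof -
      have ext: "extension_at j (decide_after j w \<alpha>) \<alpha>"
        using decide_after_extension[OF assms(1) that(1)] .
      moreover have "decide_after j w \<alpha> X (j + 1) = w"
        using that by (auto simp: decide_after_def)
      ultimately show ?thesis
        using all DI9_classical_Atom_eq[of "decide_after j w \<alpha>" X "j + 1" w] that(1)
        by (simp add: extension_at_def)
    qed
    then show "DI9_interp \<alpha> (Atom X) j = v"
      by (metis DI9_interp.simps(1) insertCI val.distinct)
  qed
next
  case (Neg B)
  have "DI9_classical \<beta> (Neg B) = T \<longleftrightarrow> DI9_classical \<beta> B = F"
    "DI9_classical \<beta> (Neg B) = F \<longleftrightarrow> DI9_classical \<beta> B = T" for \<beta>
    using DI9_classical_not_Zero[of \<beta> B] by (cases "DI9_classical \<beta> B"; simp)+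
  moreover have "DI9_interp \<alpha> (Neg B) j = T \<longleftrightarrow> DI9_interp \<alpha> B j = F"
    "DI9_interp \<alpha> (Neg B) j = F \<longleftrightarrow> DI9_interp \<alpha> B j = T"
    by (cases "DI9_interp \<alpha> B j"; simp)+
  ultimately show ?case
    using Neg.IH[of T] Neg.IH[of F] Neg.prems by (cases v)
      (simp_all del: DI9_interp.simps DI9_classical.simps)
next
  case (Disj B C)
  \<comment> \<open>The disjunction clause is already supervaluational. That some extension exists
    makes its two tests exclusive, so the \<open>F\<close> case is not masked by the earlier test
    for \<open>T\<close>.\<close>
  have "extension_at j \<alpha> \<alpha>"
    using assms(1) by (simp add: extension_at_def)
  moreover have "DI9_classical \<beta> (Disj B C) = T \<longleftrightarrow> DI9_classical \<beta> B = T \<or> DI9_classical \<beta> C = T"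
    "DI9_classical \<beta> (Disj B C) = F \<longleftrightarrow> DI9_classical \<beta> B = F \<and> DI9_classical \<beta> C = F" for \<beta>
    using DI9_classical_not_Zero[of \<beta>] by (auto intro: val.exhaust)
  ultimately show ?case
    using Disj.prems by (cases v) (auto simp del: DI9_classical.simps)
qed

theorem proposition6:
  fixes A :: "'a form" and \<Gamma> :: "'a form set"
  assumes "infinite (UNIV :: 'a set)"
    and "tautological_consequence \<Gamma> A"
  shows "DI9_consequence \<Gamma> A"
  unfolding DI9_consequence_def satisfies_at_def
proof (intro allI impI)
  fix j and \<alpha> :: "'a \<Rightarrow> real \<Rightarrow> val"
  assume \<alpha>: "DI9_valuation \<alpha>" and "\<forall>B\<in>\<Gamma>. DI9_interp \<alpha> B j = T"
  then have "\<forall>B\<in>\<Gamma>. DI9_classical \<beta> B = T" if "extension_at j \<beta> \<alpha>" for \<beta>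
    using that DI9_interp_supervaluation[OF \<alpha>, of T] by blast
  then have "DI9_classical \<beta> A = T" if "extension_at j \<beta> \<alpha>" for \<beta>
    using that assms(2) classical_interpretation_DI9_classical
    unfolding tautological_consequence_def by blast
  then show "DI9_interp \<alpha> A j = T"
    using DI9_interp_supervaluation[OF \<alpha>, of T] by blast
qed

end
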